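(* Let $G$ be a Hausdorff topological group and $H$ a closed subgroup of $G$ (with the subspace topology). Then $\operatorname{asdim}(H)\le\operatorname{asdim}(G)$.
   Context: Coarse structure: a coarse structure on a set $Y$ is a collection $\mathcal{E}$ of subsets of $Y\times Y$ (entourages) that contains the diagonal and is closed under subsets, finite unions, inverses $E^{-1}=\{(y,x) : (x,y)\in E\}$ and compositions $E_1\circ E_2=\{(x,z) : \exists y,\ (x,y)\in E_1,\ (y,z)\in E_2\}$. Group-compact coarse structure: for a Hausdorff topological group $G$, it is $\mathcal{E}_{\mathcal{C}(G)}=\{E\subset G\times G : E\subset G(K\times K) \text{ for some compact } K\subset G\}$, where $G(K\times K)=\{(ga,gb) : g\in G,\ a,b\in K\}$. Asymptotic dimension: for a coarse space $(Y,\mathcal{E})$ and an integer $n\ge 0$, $\operatorname{asdim}(Y,\mathcal{E})\le n$ means that for every $L\in\mathcal{E}$ there is a cover $\mathcal{U}=\mathcal{U}_0\cup\dots\cup\mathcal{U}_n$ of $Y$ such that each $\mathcal{U}_i$ is $L$-disjoint (for all $A\ne B$ in $\mathcal{U}_i$, $(A\times B)\cap L=\emptyset$) and $\mathcal{U}$ is uniformly bounded (there is $M\in\mathcal{E}$ with $A\times A\subset M$ for all $A\in\mathcal{U}$). $\operatorname{asdim}(Y,\mathcal{E})$ is the least such $n$, or $\infty$ if there is none. For a Hausdorff topological group $G$, $\operatorname{asdim}(G):=\operatorname{asdim}(G,\mathcal{E}_{\mathcal{C}(G)})$. *)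

theory Defs
  imports "HOL-Analysis.Analysis" "HOL-Algebra.Group"
begin

definition coarse_structure :: "'a set \<Rightarrow> ('a \<times> 'a) set set \<Rightarrow> bool" where
  "coarse_structure Y \<E> \<longleftrightarrow>
     \<E> \<subseteq> Pow (Y \<times> Y) \<and> Id_on Y \<in> \<E> \<and>
     (\<forall>E\<in>\<E>. \<forall>F. F \<subseteq> E \<longrightarrow> F \<in> \<E>) \<and>
     (\<forall>E\<in>\<E>. \<forall>F\<in>\<E>. E \<union> F \<in> \<E>) \<and>
     (\<forall>E\<in>\<E>. E\<inverse> \<in> \<E>) \<and>
     (\<forall>E\<in>\<E>. \<forall>F\<in>\<E>. E O F \<in> \<E>)"

definition entourage_disjoint :: "('a \<times> 'a) set \<Rightarrow> 'a set set \<Rightarrow> bool" where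
  "entourage_disjoint L \<U> \<longleftrightarrow> (\<forall>A\<in>\<U>. \<forall>B\<in>\<U>. A \<noteq> B \<longrightarrow> (A \<times> B) \<inter> L = {})"

definition uniformly_bounded :: "('a \<times> 'a) set set \<Rightarrow> 'a set set \<Rightarrow> bool" where
  "uniformly_bounded \<E> \<U> \<longleftrightarrow> (\<exists>M\<in>\<E>. \<forall>A\<in>\<U>. A \<times> A \<subseteq> M)"

definition asdim_le :: "'a set \<Rightarrow> ('a \<times> 'a) set set \<Rightarrow> nat \<Rightarrow> bool" where
  "asdim_le Y \<E> n \<longleftrightarrow>
     (\<forall>L\<in>\<E>. \<exists>\<U> :: nat \<Rightarrow> 'a set set.
        \<Union>(\<Union>i\<le>n. \<U> i) = Y \<and>
        (\<forall>i\<le>n. entourage_disjoint L (\<U> i)) \<and>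
        uniformly_bounded \<E> (\<Union>i\<le>n. \<U> i))"

definition asdim :: "'a set \<Rightarrow> ('a \<times> 'a) set set \<Rightarrow> enat" where
  "asdim Y \<E> = (if \<exists>n. asdim_le Y \<E> n then enat (LEAST n. asdim_le Y \<E> n) else \<infinity>)"

locale hausdorff_topological_group = group G for G (structure) +
  fixes T :: "'a topology"
  assumes topspace_eq: "topspace T = carrier G"
    and continuous_mult: "continuous_map (prod_topology T T) T (\<lambda>(x, y). x \<otimes> y)"
    and continuous_inv: "continuous_map T T (\<lambda>x. inv x)"
    and hausdorff: "Hausdorff_space T"

definition group_compact_coarse ::
    "('a, 'b) monoid_scheme \<Rightarrow> 'a topology \<Rightarrow> ('a \<times> 'a) set set" where
  "group_compact_coarse G T =
     {E. E \<subseteq> carrier G \<times> carrier G \<and>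
         (\<exists>K. compactin T K \<and>
              E \<subseteq> {(g \<otimes>\<^bsub>G\<^esub> a, g \<otimes>\<^bsub>G\<^esub> b) | g a b. g \<in> carrier G \<and> a \<in> K \<and> b \<in> K})}"

definition asdim_group :: "('a, 'b) monoid_scheme \<Rightarrow> 'a topology \<Rightarrow> enat" where
  "asdim_group G T = asdim (carrier G) (group_compact_coarse G T)"

lemma (in hausdorff_topological_group) coarse_structure_group_compact:
  "coarse_structure (carrier G) (group_compact_coarse G T)"
proof -
  let ?S = "\<lambda>K. {(g \<otimes> a, g \<otimes> b) | g a b. g \<in> carrier G \<and> a \<in> K \<and> b \<in> K}"
  have mem: "E \<in> group_compact_coarse G T \<longleftrightarrow>
      E \<subseteq> carrier G \<times> carrier G \<and> (\<exists>K. compactin T K \<and> E \<subseteq> ?S K)" for E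
    by (simp add: group_compact_coarse_def)
  have diag: "Id_on (carrier G) \<in> group_compact_coarse G T"
  proof -
    have "compactin T {\<one>}" by (simp add: topspace_eq)
    moreover have "Id_on (carrier G) \<subseteq> ?S {\<one>}"
      by (force simp: Id_on_def)
    moreover have "Id_on (carrier G) \<subseteq> carrier G \<times> carrier G"
      by (auto simp: Id_on_def)
    ultimately show ?thesis unfolding mem by blast
  qed
  have un: "E \<union> F \<in> group_compact_coarse G T"
    if EF: "E \<in> group_compact_coarse G T" "F \<in> group_compact_coarse G T" for E F
  proof -
    obtain K K' where K: "compactin T K" "E \<subseteq> ?S K" "compactin T K'" "F \<subseteq> ?S K'"
      using EF unfolding mem by blast
    have "?S K \<subseteq> ?S (K \<union> K')" "?S K' \<subseteq> ?S (K \<union> K')" by blast+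
    then have "E \<union> F \<subseteq> ?S (K \<union> K')" using K by (meson Un_least order_trans)
    moreover have "compactin T (K \<union> K')" using K by (simp add: compactin_Un)
    ultimately show ?thesis using EF unfolding mem by blast
  qed
  have conv: "E\<inverse> \<in> group_compact_coarse G T" if EF: "E \<in> group_compact_coarse G T" for E
  proof -
    obtain K where K: "compactin T K" "E \<subseteq> ?S K"
      using EF unfolding mem by blast
    have "E\<inverse> \<subseteq> (?S K)\<inverse>" using K(2) by blast
    also have "(?S K)\<inverse> \<subseteq> ?S K" by blast
    finally have "E\<inverse> \<subseteq> ?S K" .
    moreover have "E\<inverse> \<subseteq> carrier G \<times> carrier G"
      using EF unfolding mem by blast
    ultimately show ?thesis using K(1) unfolding mem by (intro conjI exI[of _ K])
  qed
  have comp: "E O F \<in> group_compact_coarse G T"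
    if EF: "E \<in> group_compact_coarse G T" "F \<in> group_compact_coarse G T" for E F
  proof -
    obtain K K' where K: "compactin T K" "E \<subseteq> ?S K" "compactin T K'" "F \<subseteq> ?S K'"
      using EF unfolding mem by blast
    have sub: "K \<subseteq> carrier G" "K' \<subseteq> carrier G"
      using K compactin_subset_topspace topspace_eq by blast+
    have mult: "compactin T ((\<lambda>(x, y). x \<otimes> y) ` (A \<times> B))"
      if "compactin T A" "compactin T B" for A B
      using that by (intro image_compactin[OF _ continuous_mult]) (simp add: compactin_Times)
    have inv': "compactin T ((\<lambda>x. inv x) ` K')"
      using K by (intro image_compactin[OF _ continuous_inv])
    define P where "P = (\<lambda>(x, y). x \<otimes> y) ` (((\<lambda>(x, y). x \<otimes> y) ` (K \<times> (\<lambda>x. inv x) ` K')) \<times> K')"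
    have "compactin T (K \<union> P)"
      unfolding P_def using K mult inv' by (intro compactin_Un) auto
    moreover have "E O F \<subseteq> ?S (K \<union> P)"
    proof
      fix p assume "p \<in> E O F"
      then obtain x y z where p: "p = (x, z)" "(x, y) \<in> E" "(y, z) \<in> F" by blast
      obtain g a b where 1: "x = g \<otimes> a" "y = g \<otimes> b" "g \<in> carrier G" "a \<in> K" "b \<in> K"
        using subsetD[OF K(2) p(2)] by blast
      obtain h c d where 2: "y = h \<otimes> c" "z = h \<otimes> d" "h \<in> carrier G" "c \<in> K'" "d \<in> K'"
        using subsetD[OF K(4) p(3)] by blast
      have car: "a \<in> carrier G" "b \<in> carrier G" "c \<in> carrier G" "d \<in> carrier G"
        using 1 2 sub by auto
      have "h = g \<otimes> b \<otimes> inv c"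
        using 1(1-3) 2(1,3) car inv_solve_right[of h "g \<otimes> b" c] by simp
      then have "z = g \<otimes> (b \<otimes> inv c \<otimes> d)"
        using 1 2 car by (simp add: m_assoc)
      moreover have "b \<otimes> inv c \<otimes> d \<in> P"
        unfolding P_def using 1(5) 2(4,5)
        by (intro image_eqI[where x = "(b \<otimes> inv c, d)"] SigmaI
            image_eqI[where x = "(b, inv c)"] imageI) simp_all
      ultimately have "p = (g \<otimes> a, g \<otimes> (b \<otimes> inv c \<otimes> d))" "b \<otimes> inv c \<otimes> d \<in> K \<union> P" "a \<in> K \<union> P"
        using p(1) 1 by simp_all
      then show "p \<in> ?S (K \<union> P)" using 1(3) by blast
    qed
    moreover have "E O F \<subseteq> carrier G \<times> carrier G"
      using EF unfolding mem by blast
    ultimately show ?thesis unfolding mem by (intro conjI exI[of _ "K \<union> P"])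
  qed
  have sub1: "group_compact_coarse G T \<subseteq> Pow (carrier G \<times> carrier G)"
    unfolding group_compact_coarse_def by blast
  have sub2: "F \<in> group_compact_coarse G T" if "E \<in> group_compact_coarse G T" "F \<subseteq> E" for E F
    using that unfolding mem by (meson order_trans)
  show ?thesis
    unfolding coarse_structure_def
    by (intro conjI ballI allI impI sub1 diag un conv comp; (erule (1) sub2)?; assumption)
qed

lemma (in hausdorff_topological_group) subgroup_hausdorff_topological_group:
  assumes "subgroup H G"
  shows "hausdorff_topological_group (G\<lparr>carrier := H\<rparr>) (subtopology T H)"
proof -
  interpret H: group "G\<lparr>carrier := H\<rparr>"
    using assms by (rule subgroup_imp_group)
  have sub: "H \<subseteq> carrier G" using assms by (rule subgroup.subset)
  have top: "topspace (subtopology T H) = H"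
    using sub by (simp add: topspace_eq inf_absorb2)
  have "continuous_map (prod_topology (subtopology T H) (subtopology T H)) (subtopology T H)
      (\<lambda>(x, y). x \<otimes> y)"
    using continuous_mult assms sub
    by (auto simp: continuous_map_in_subtopology topspace_eq subgroup.m_closed
        simp flip: subtopology_Times intro: continuous_map_from_subtopology)
  moreover have "continuous_map (subtopology T H) (subtopology T H) (\<lambda>x. inv x)"
    using continuous_inv assms sub
    by (auto simp: continuous_map_in_subtopology topspace_eq subgroup.m_inv_closed
        intro: continuous_map_from_subtopology)
  then have "continuous_map (subtopology T H) (subtopology T H) (\<lambda>x. inv\<^bsub>G\<lparr>carrier := H\<rparr>\<^esub> x)"
    by (rule continuous_map_eq) (use assms top in \<open>simp add: m_inv_consistent\<close>)
  moreover have "Hausdorff_space (subtopology T H)"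
    using hausdorff by (rule Hausdorff_space_subtopology)
  ultimately show ?thesis
    using top by unfold_locales auto
qed

end

theory Submission
  imports Defs
begin

text \<open>
  The coarse structure of a closed subgroup \<open>H\<close> is the restriction of that of \<open>G\<close>:
  if \<open>x = ga\<close> and \<open>y = gb\<close> lie in \<open>H\<close> with \<open>a, b \<in> K\<close>, then \<open>x\<inverse>y = a\<inverse>b\<close> lies in
  \<open>K\<inverse>K \<inter> H\<close>, which is compact because \<open>H\<close> is closed. Covers witnessing the asymptotic
  dimension of \<open>G\<close> then restrict to \<open>H\<close> by intersection.
\<close>

text \<open>Intersecting the members of a cover of \<open>Y\<close> with \<open>Z\<close> only
  shrinks them, so disjointness survives, and a bound \<open>M\<close> can be cut down to
  \<open>Z \<times> Z\<close>; \<open>down\<close> keeps the smaller set in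
  \<open>\<E>\<close>.\<close>

lemma asdim_le_restrict:
  assumes le: "asdim_le Y \<E> n"
    and down: "\<And>E F. E \<in> \<E> \<Longrightarrow> F \<subseteq> E \<Longrightarrow> F \<in> \<E>"
    and "Z \<subseteq> Y"
  shows "asdim_le Z {E \<in> \<E>. E \<subseteq> Z \<times> Z} n"
  unfolding asdim_le_def
proof
  fix L assume "L \<in> {E \<in> \<E>. E \<subseteq> Z \<times> Z}"
  then have "L \<in> \<E>" by simp
  then obtain \<U> :: "nat \<Rightarrow> 'a set set"
    where cover: "\<Union>(\<Union>i\<le>n. \<U> i) = Y"
      and disj: "\<forall>i\<le>n. entourage_disjoint L (\<U> i)"
      and bdd: "uniformly_bounded \<E> (\<Union>i\<le>n. \<U> i)"
    using le[unfolded asdim_le_def, rule_format] by metis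
  obtain M where M: "M \<in> \<E>" "\<forall>A\<in>(\<Union>i\<le>n. \<U> i). A \<times> A \<subseteq> M"
    using bdd unfolding uniformly_bounded_def by (elim bexE)
  define \<V> where "\<V> i = (\<lambda>A. A \<inter> Z) ` \<U> i" for i
  have "\<Union>(\<Union>i\<le>n. \<V> i) = \<Union>(\<Union>i\<le>n. \<U> i) \<inter> Z"
    unfolding \<V>_def by blast
  then have "\<Union>(\<Union>i\<le>n. \<V> i) = Z"
    using cover \<open>Z \<subseteq> Y\<close> by blast
  \<comment> \<open>Distinct traces \<open>A \<inter> Z\<close> and \<open>B \<inter> Z\<close> come
    from distinct \<open>A\<close> and \<open>B\<close>, and their product lies in
    \<open>A \<times> B\<close>, which misses \<open>L\<close>.\<close>
  moreover have "\<forall>i\<le>n. entourage_disjoint L (\<V> i)"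
    using disj unfolding entourage_disjoint_def \<V>_def by blast
  moreover have "uniformly_bounded {E \<in> \<E>. E \<subseteq> Z \<times> Z} (\<Union>i\<le>n. \<V> i)"
    unfolding uniformly_bounded_def
  proof
    show "M \<inter> Z \<times> Z \<in> {E \<in> \<E>. E \<subseteq> Z \<times> Z}"
      using down[OF M(1)] by blast
    show "\<forall>A\<in>(\<Union>i\<le>n. \<V> i). A \<times> A \<subseteq> M \<inter> Z \<times> Z"
      using M(2) unfolding \<V>_def by blast
  qed
  ultimately show "\<exists>\<V>. \<Union>(\<Union>i\<le>n. \<V> i) = Z \<and> (\<forall>i\<le>n. entourage_disjoint L (\<V> i)) \<and>
      uniformly_bounded {E \<in> \<E>. E \<subseteq> Z \<times> Z} (\<Union>i\<le>n. \<V> i)"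
    by (intro exI[of _ \<V>] conjI)
qed

text \<open>Every finite bound for \<open>Y\<close> passes to \<open>Z\<close>, in particular the
  least one; if there is none, the right-hand side is \<open>\<infinity>\<close>.\<close>

lemma asdim_mono:
  assumes "\<And>n. asdim_le Y \<E> n \<Longrightarrow> asdim_le Z \<F> n"
  shows "asdim Z \<F> \<le> asdim Y \<E>"
proof (cases "\<exists>n. asdim_le Y \<E> n")
  case True
  then have "asdim_le Z \<F> (LEAST n. asdim_le Y \<E> n)"
    by (rule assms[OF LeastI_ex])
  then show ?thesis
    using True by (auto simp: asdim_def intro: Least_le)
qed (simp add: asdim_def)

text \<open>From left to right, a compact subset of the subspace is compact in \<open>T\<close>, and
  letting \<open>g\<close> range over all of \<open>G\<close> only weakens the condition. In the
  other direction \<open>g\<close> may lie outside \<open>H\<close>, so each pair has to be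
  rewritten with a base point in \<open>H\<close>.\<close>

lemma (in hausdorff_topological_group) group_compact_coarse_closed_subgroup:
  assumes H: "subgroup H G" and cl: "closedin T H"
  shows "group_compact_coarse (G\<lparr>carrier := H\<rparr>) (subtopology T H) =
    {E \<in> group_compact_coarse G T. E \<subseteq> H \<times> H}"
proof (intro equalityI subsetI)
  have HG: "H \<subseteq> carrier G" using H by (rule subgroup.subset)
  {
    fix E assume "E \<in> group_compact_coarse (G\<lparr>carrier := H\<rparr>) (subtopology T H)"
    then obtain K where K: "compactin (subtopology T H) K" and EH: "E \<subseteq> H \<times> H"
      and E: "E \<subseteq> {(g \<otimes> a, g \<otimes> b) | g a b. g \<in> H \<and> a \<in> K \<and> b \<in> K}"
      unfolding group_compact_coarse_def by auto
    have "compactin T K" using K by (simp add: compactin_subtopology)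
    moreover have "E \<subseteq> {(g \<otimes> a, g \<otimes> b) | g a b. g \<in> carrier G \<and> a \<in> K \<and> b \<in> K}"
      using E HG by blast
    moreover have "E \<subseteq> carrier G \<times> carrier G" using EH HG by blast
    ultimately show "E \<in> {E \<in> group_compact_coarse G T. E \<subseteq> H \<times> H}"
      using EH unfolding group_compact_coarse_def by blast
  next
    fix E assume "E \<in> {E \<in> group_compact_coarse G T. E \<subseteq> H \<times> H}"
    then obtain K where K: "compactin T K" and EH: "E \<subseteq> H \<times> H"
      and E: "E \<subseteq> {(g \<otimes> a, g \<otimes> b) | g a b. g \<in> carrier G \<and> a \<in> K \<and> b \<in> K}"
      unfolding group_compact_coarse_def by blast
    have KG: "K \<subseteq> carrier G"
      using K compactin_subset_topspace topspace_eq by blast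
    define C where "C = (\<lambda>(x, y). x \<otimes> y) ` ((\<lambda>x. inv x) ` K \<times> K)"
    have "compactin T ((\<lambda>x. inv x) ` K)"
      using K continuous_inv by (rule image_compactin)
    then have "compactin T C"
      unfolding C_def using K
      by (intro image_compactin[OF _ continuous_mult]) (simp add: compactin_Times)
    then have "compactin T (H \<inter> C)"
      using cl by (rule closed_Int_compactin[rotated])
    \<comment> \<open>With \<open>g \<otimes> a\<close> as the new base point, the first coordinate
      of a pair corresponds to \<open>\<one>\<close>, so \<open>\<one>\<close> is put into the
      compact set.\<close>
    then have "compactin T (insert \<one> (H \<inter> C))"
      using compactin_Un[of T "{\<one>}" "H \<inter> C"] by (simp add: topspace_eq)
    then have "compactin (subtopology T H) (insert \<one> (H \<inter> C))"
      using H by (simp add: compactin_subtopology subgroup.one_closed)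
    moreover have "E \<subseteq> {(g \<otimes> a, g \<otimes> b) | g a b.
        g \<in> H \<and> a \<in> insert \<one> (H \<inter> C) \<and> b \<in> insert \<one> (H \<inter> C)}"
    proof
      fix p assume "p \<in> E"
      then obtain g a b where p: "p = (g \<otimes> a, g \<otimes> b)"
        and g: "g \<in> carrier G" and ab: "a \<in> K" "b \<in> K"
        using E by blast
      have G: "a \<in> carrier G" "b \<in> carrier G" using ab KG by auto
      have xy: "g \<otimes> a \<in> H" "g \<otimes> b \<in> H" using \<open>p \<in> E\<close> EH p by auto
      \<comment> \<open>The factor \<open>g\<close> cancels: the same element is a quotient of two
        members of \<open>H\<close> and of two members of \<open>K\<close>, hence lies in
        \<open>H \<inter> C\<close>.\<close>
      have eq: "inv (g \<otimes> a) \<otimes> (g \<otimes> b) = inv a \<otimes> b"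
        using g G by (simp add: inv_solve_left' m_assoc) (simp flip: m_assoc)
      have "inv a \<otimes> b \<in> H"
        using H xy by (metis eq subgroup.m_closed subgroup.m_inv_closed)
      moreover have "inv a \<otimes> b \<in> C"
        unfolding C_def using ab by force
      moreover have "p = ((g \<otimes> a) \<otimes> \<one>, (g \<otimes> a) \<otimes> (inv a \<otimes> b))"
        using p g G by (simp add: m_assoc) (simp flip: m_assoc)
      ultimately show "p \<in> {(g \<otimes> a, g \<otimes> b) | g a b.
          g \<in> H \<and> a \<in> insert \<one> (H \<inter> C) \<and> b \<in> insert \<one> (H \<inter> C)}"
        using xy by blast
    qed
    ultimately show "E \<in> group_compact_coarse (G\<lparr>carrier := H\<rparr>) (subtopology T H)"
      using EH unfolding group_compact_coarse_def partial_object.simps monoid.simps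
      by (intro CollectI conjI exI[of _ "insert \<one> (H \<inter> C)"]) simp_all
  }
qed

theorem corollary3p11:
  fixes G :: "('a, 'b) monoid_scheme" and T :: "'a topology" and H :: "'a set"
  assumes "hausdorff_topological_group G T"
    and "subgroup H G"
    and "closedin T H"
  shows "asdim_group (G\<lparr>carrier := H\<rparr>) (subtopology T H) \<le> asdim_group G T"
proof -
  interpret hausdorff_topological_group G T by fact
  have "asdim_le H {E \<in> group_compact_coarse G T. E \<subseteq> H \<times> H} n"
    if "asdim_le (carrier G) (group_compact_coarse G T) n" for n
    using that
  proof (rule asdim_le_restrict)
    show "F \<in> group_compact_coarse G T" if "E \<in> group_compact_coarse G T" "F \<subseteq> E" for E F
      using coarse_structure_group_compact that unfolding coarse_structure_def by blast
    show "H \<subseteq> carrier G"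
      using assms(2) by (rule subgroup.subset)
  qed
  \<comment> \<open>The intrinsic coarse structure of \<open>H\<close> is rewritten as the
    restricted one, for which the bounds have just been transferred.\<close>
  then show ?thesis
    unfolding asdim_group_def
    by (simp add: group_compact_coarse_closed_subgroup[OF assms(2,3)] asdim_mono)
qed

end
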